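(* Let $a_0,b_0,c_0>0$ be initial conductances on $V_0$ for which the recursive construction (see context) of a Dirichlet form $\mathcal E$ on the Sierpinski gasket $K$ can be carried out. Then there are only two cases: either (i) $a_0=b_0=c_0$, and in this case $\mathcal E$ is, up to a positive constant multiple, the standard Dirichlet form $$u\mapsto\lim_{n\to\infty}\Big(\frac53\Big)^n\sum_{p\sim_nq}(u(p)-u(q))^2;$$ or (ii) $a_0>b_0=c_0$ (or one of the symmetric alternatives $b_0>c_0=a_0$, $c_0>a_0=b_0$), and, for $a_0>b_0=c_0$, the Dirichlet form satisfies $$\mathcal E(u)\asymp\sup_{n\ge0}\left\{2^n\sum_{\omega\in W_n}\left(\big(u_\omega(p_2)-u_\omega(p_3)\big)^2+\Big(\frac34\Big)^n\big(u_\omega(p_1)-u_\omega(p_2)\big)^2+\Big(\frac34\Big)^n\big(u_\omega(p_1)-u_\omega(p_3)\big)^2\right)\right\}$$ (and the analogous estimate with the roles of $p_1,p_2,p_3$ permuted in the symmetric alternatives), where $u_\omega=u\circ F_\omega$.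
   Context: Identify $\mathbb R^2$ with $\mathbb C$ and let $p_1=0$, $p_2=1$, $p_3=e^{\pi\sqrt{-1}/3}$, $F_i(x)=\frac12(x-p_i)+p_i$ ($i=1,2,3$). The Sierpinski gasket $K$ is the unique nonempty compact set with $K=\bigcup_{i=1}^3F_i(K)$. Let $V_0=\{p_1,p_2,p_3\}$, $W_n=\{1,2,3\}^n$, $F_\omega=F_{\omega_1}\circ\cdots\circ F_{\omega_n}$ for $\omega\in W_n$. Write $p\sim_nq$ if $p\ne q$ and $p,q\in F_\omega(V_0)$ for some $\omega\in W_n$ (sums over $p\sim_n q$ are over unordered pairs). Recursive construction: given $a_0,b_0,c_0>0$, put $\eta_0=a_0b_0+b_0c_0+c_0a_0$ and $(x_0,y_0,z_0)=(a_0,b_0,c_0)/\eta_0$. The construction can be carried out if there are positive triples $(x_n,y_n,z_n)$, $n\ge1$, satisfying for all $n\ge1$ $$x_{n-1}=x_n+\phi(x_n;y_n,z_n),\quad y_{n-1}=y_n+\phi(y_n;z_n,x_n),\quad z_{n-1}=z_n+\phi(z_n;x_n,y_n),$$ with $\phi(x;y,z)=\frac{(x+y)(x+z)}{2(x+y+z)}$. In that case put $r_n=x_ny_n+y_nz_n+z_nx_n$, $(a_n,b_n,c_n)=(x_n,y_n,z_n)/r_n$, and for $u\in C(K)$ $$\mathcal E_n(u)=\sum_{\omega\in W_n}\Big[a_n(u_\omega(p_2)-u_\omega(p_3))^2+b_n(u_\omega(p_1)-u_\omega(p_3))^2+c_n(u_\omega(p_1)-u_\omega(p_2))^2\Big],$$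 which is nondecreasing in $n$; the resulting Dirichlet form is $\mathcal E(u)=\lim_{n\to\infty}\mathcal E_n(u)$ with domain $\{u\in C(K):\mathcal E(u)<\infty\}$. For quantities $f,g$ with values in $[0,\infty]$, $f\asymp g$ means $C^{-1}g\le f\le Cg$ for a constant $C>0$ independent of $u\in C(K)$ (but possibly depending on the initial data). *)

theory Defs
  imports "HOL-Analysis.Analysis"
begin

definition vtx :: "nat \<Rightarrow> complex" where
  "vtx i = (if i = 1 then 0 else if i = 2 then 1 else exp (complex_of_real pi * \<i> / 3))"

definition V0 :: "complex set" where
  "V0 = {vtx 1, vtx 2, vtx 3}"

definition F :: "nat \<Rightarrow> complex \<Rightarrow> complex" where
  "F i x = (x - vtx i) / 2 + vtx i"

definition is_gasket :: "complex set \<Rightarrow> bool" where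
  "is_gasket K \<longleftrightarrow> K \<noteq> {} \<and> compact K \<and> K = (\<Union>i\<in>{1,2,3}. F i ` K)"

definition gasket :: "complex set" where
  "gasket = (THE K. is_gasket K)"

text \<open>The description in \<open>gasket\<close> is proper: existence and uniqueness.\<close>

lemma dist_F: "dist (F i x) (F i y) = dist x y / 2"
proof -
  have "F i x - F i y = (x - y) / 2" by (simp add: F_def field_simps)
  then show ?thesis unfolding dist_norm by (simp only: norm_divide norm_numeral)
qed

lemma inj_F: "inj (F i)"
  by (rule injI) (simp add: F_def)

lemma cont_F: "continuous_on S (F i)"
  unfolding F_def by (intro continuous_intros) auto

lemma norm_vtx: "norm (vtx i) \<le> 1"
proof -
  have "norm (exp (complex_of_real pi * \<i> / 3)) = 1"
    by (simp add: norm_exp_eq_Re)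
  then show ?thesis by (simp add: vtx_def)
qed

lemma gasket_subset:
  assumes "is_gasket K" "is_gasket L"
  shows "K \<subseteq> L"
proof -
  have K: "K \<noteq> {}" "compact K" "K = (\<Union>i\<in>{1,2,3}. F i ` K)"
    and L: "L \<noteq> {}" "compact L" "L = (\<Union>i\<in>{1,2,3}. F i ` L)"
    using assms unfolding is_gasket_def by blast+
  have "continuous_on K (\<lambda>x. infdist x L)"
    by (intro continuous_intros)
  then obtain m where m: "m \<in> K" "\<And>x. x \<in> K \<Longrightarrow> infdist x L \<le> infdist m L"
    using continuous_attains_sup[OF K(2,1)] by blast
  obtain i x where ix: "i \<in> {1,2,3}" "x \<in> K" "m = F i x"
    using m(1) K(3) by blast
  have "closed L" using L(2) by (rule compact_imp_closed)
  then obtain y where y: "y \<in> L" "infdist x L = dist x y"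
    using infdist_attains_inf L(1) by metis
  have "F i y \<in> L" using y(1) ix(1) L(3) by blast
  then have "infdist m L \<le> dist m (F i y)" by (rule infdist_le)
  also have "\<dots> = infdist x L / 2" using ix(3) y(2) dist_F by simp
  also have "\<dots> \<le> infdist m L / 2" using m(2) ix(2) by simp
  finally have "infdist m L \<le> 0" by simp
  then have "infdist x L = 0" if "x \<in> K" for x
    using m(2)[OF that] infdist_nonneg[of x L] by linarith
  then show ?thesis
    using in_closed_iff_infdist_zero[OF \<open>closed L\<close> L(1)] by blast
qed

lemma gasket_exists: "\<exists>K. is_gasket K"
proof -
  define H where "H = (\<lambda>S. \<Union>i\<in>{1,2,3::nat}. F i ` S)"
  define T where "T = (\<lambda>n. (H ^^ n) (cball 0 1))"
  have T0: "T 0 = cball 0 1" and TS: "\<And>n. T (Suc n) = H (T n)"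
    by (simp_all add: T_def)
  have Hmono: "H A \<subseteq> H B" if "A \<subseteq> B" for A B
    using that unfolding H_def by blast
  have "F i x \<in> cball 0 1" if "x \<in> cball 0 1" for i x
  proof -
    have "F i x = (x + vtx i) / 2" by (simp add: F_def field_simps)
    then have "norm (F i x) = norm (x + vtx i) / 2"
      by (simp only: norm_divide norm_numeral)
    also have "\<dots> \<le> (norm x + norm (vtx i)) / 2"
      by (simp add: norm_triangle_ineq)
    finally have "norm (F i x) \<le> (norm x + norm (vtx i)) / 2" .
    then show ?thesis using that norm_vtx[of i] by simp
  qed
  then have "H (cball 0 1) \<subseteq> cball 0 1" unfolding H_def by blast
  then have dec1: "T (Suc n) \<subseteq> T n" for n
    by (induction n) (simp_all add: T0 TS Hmono)
  have dec: "T n \<subseteq> T m" if "m \<le> n" for m n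
    using lift_Suc_antimono_le[of T] dec1 that by blast
  have cpt: "compact (T n)" for n
  proof (induction n)
    case 0 then show ?case by (simp add: T0)
  next
    case (Suc n)
    have "compact (F i ` T n)" for i
      by (rule compact_continuous_image[OF cont_F Suc])
    then show ?case unfolding TS H_def by (intro compact_UN) auto
  qed
  have ne: "T n \<noteq> {}" for n
    by (induction n) (auto simp: T0 TS H_def)
  define K where "K = \<Inter>(range T)"
  have "K \<noteq> {}" unfolding K_def
    by (rule compact_nest[OF cpt ne dec])
  moreover have "compact K" unfolding K_def
    by (rule compact_Inter) (use cpt in auto)
  moreover have "K = H K"
  proof
    show "H K \<subseteq> K"
    proof -
      have "H K \<subseteq> T (Suc n)" for n unfolding TS by (rule Hmono) (auto simp: K_def)
      then have "H K \<subseteq> T n" for n using dec1 by blast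
      then show ?thesis unfolding K_def by blast
    qed
    show "K \<subseteq> H K"
    proof
      fix x assume "x \<in> K"
      then have xT: "\<And>n. x \<in> H (T n)" unfolding K_def TS[symmetric] by blast
      have "\<exists>i\<in>{1,2,3}. \<forall>n. x \<in> F i ` T n"
      proof (rule ccontr)
        assume "\<not> ?thesis"
        then obtain k where k: "\<And>i. i \<in> {1,2,3::nat} \<Longrightarrow> x \<notin> F i ` T (k i)"
          by metis
        define N where "N = k 1 + k 2 + k 3"
        obtain i where i: "i \<in> {1,2,3::nat}" "x \<in> F i ` T N"
          using xT[of N] unfolding H_def by blast
        have "k i \<le> N" using i(1) by (auto simp: N_def)
        then show False using k[OF i(1)] i(2) dec by blast
      qed
      then obtain i where i: "i \<in> {1,2,3}" "\<And>n. x \<in> F i ` T n" by blast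
      then obtain y where y: "x = F i y" by blast
      have "y \<in> T n" for n
        using i(2)[of n] y inj_F[of i] by (auto dest: injD)
      then have "y \<in> K" unfolding K_def by blast
      then show "x \<in> H K" using i(1) y unfolding H_def by blast
    qed
  qed
  ultimately show ?thesis unfolding is_gasket_def H_def by blast
qed

lemma is_gasket_gasket: "is_gasket gasket"
  unfolding gasket_def
  by (rule theI') (use gasket_exists gasket_subset in blast)

definition W :: "nat \<Rightarrow> nat list set" where
  "W n = {\<omega>. length \<omega> = n \<and> set \<omega> \<subseteq> {1,2,3}}"

definition Fw :: "nat list \<Rightarrow> complex \<Rightarrow> complex" where
  "Fw \<omega> = foldr (\<lambda>i f. F i \<circ> f) \<omega> id"

definition adj :: "nat \<Rightarrow> complex \<Rightarrow> complex \<Rightarrow> bool" where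
  "adj n p q \<longleftrightarrow> p \<noteq> q \<and> (\<exists>\<omega>\<in>W n. p \<in> Fw \<omega> ` V0 \<and> q \<in> Fw \<omega> ` V0)"

text \<open>Functions in \<open>C(K)\<close> are represented by \<open>u :: complex \<Rightarrow> real\<close> with
  \<open>continuous_on gasket u\<close>; all the forms below evaluate \<open>u\<close> at points of \<open>gasket\<close> only.
  Each form takes values in \<open>[0,\<infinity>]\<close> and its domain is the set where it is finite;
  the limits exist in \<open>[0,\<infinity>]\<close> because the sequences are nondecreasing.\<close>

text \<open>The sum over unordered pairs is half of the sum over ordered pairs.\<close>

definition std_form :: "(complex \<Rightarrow> real) \<Rightarrow> ennreal" where
  "std_form u = lim (\<lambda>n. ennreal ((5/3) ^ n *
     ((\<Sum>(p, q)\<in>{(p, q). adj n p q}. (u p - u q)\<^sup>2) / 2)))"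

definition phi :: "real \<Rightarrow> real \<Rightarrow> real \<Rightarrow> real" where
  "phi x y z = (x + y) * (x + z) / (2 * (x + y + z))"

definition rec_construction ::
  "real \<Rightarrow> real \<Rightarrow> real \<Rightarrow> (nat \<Rightarrow> real) \<Rightarrow> (nat \<Rightarrow> real) \<Rightarrow> (nat \<Rightarrow> real) \<Rightarrow> bool" where
  "rec_construction a0 b0 c0 x y z \<longleftrightarrow>
     (let \<eta>0 = a0 * b0 + b0 * c0 + c0 * a0
      in x 0 = a0 / \<eta>0 \<and> y 0 = b0 / \<eta>0 \<and> z 0 = c0 / \<eta>0) \<and>
     (\<forall>n\<ge>1. x n > 0 \<and> y n > 0 \<and> z n > 0 \<and>
        x (n - 1) = x n + phi (x n) (y n) (z n) \<and>
        y (n - 1) = y n + phi (y n) (z n) (x n) \<and>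
        z (n - 1) = z n + phi (z n) (x n) (y n))"

definition energy_n ::
  "(nat \<Rightarrow> real) \<Rightarrow> (nat \<Rightarrow> real) \<Rightarrow> (nat \<Rightarrow> real) \<Rightarrow> nat \<Rightarrow> (complex \<Rightarrow> real) \<Rightarrow> real" where
  "energy_n x y z n u =
     (let r = x n * y n + y n * z n + z n * x n;
          a = x n / r; b = y n / r; c = z n / r
      in \<Sum>\<omega>\<in>W n. let v = u \<circ> Fw \<omega> in
           a * (v (vtx 2) - v (vtx 3))\<^sup>2 +
           b * (v (vtx 1) - v (vtx 3))\<^sup>2 +
           c * (v (vtx 1) - v (vtx 2))\<^sup>2)"

definition energy ::
  "(nat \<Rightarrow> real) \<Rightarrow> (nat \<Rightarrow> real) \<Rightarrow> (nat \<Rightarrow> real) \<Rightarrow> (complex \<Rightarrow> real) \<Rightarrow> ennreal" where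
  "energy x y z u = lim (\<lambda>n. ennreal (energy_n x y z n u))"

text \<open>In \<open>aniso i j k\<close> the edge joining \<open>vtx j\<close> and \<open>vtx k\<close>, opposite to \<open>vtx i\<close>,
  is the one without the factor \<open>(3/4)\<^sup>n\<close>.\<close>

definition aniso :: "nat \<Rightarrow> nat \<Rightarrow> nat \<Rightarrow> (complex \<Rightarrow> real) \<Rightarrow> ennreal" where
  "aniso i j k u = (SUP n. ennreal (2 ^ n * (\<Sum>\<omega>\<in>W n. let v = u \<circ> Fw \<omega> in
     (v (vtx j) - v (vtx k))\<^sup>2 +
     (3/4) ^ n * (v (vtx i) - v (vtx j))\<^sup>2 +
     (3/4) ^ n * (v (vtx i) - v (vtx k))\<^sup>2)))"

definition comparable ::
  "((complex \<Rightarrow> real) \<Rightarrow> ennreal) \<Rightarrow> ((complex \<Rightarrow> real) \<Rightarrow> ennreal) \<Rightarrow> bool" where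
  "comparable f g \<longleftrightarrow> (\<exists>C::real. C > 0 \<and> (\<forall>u. continuous_on gasket u \<longrightarrow>
     ennreal (1 / C) * g u \<le> f u \<and> f u \<le> ennreal C * g u))"

end

theory Submission
  imports Defs
begin

text \<open>
  The numbers \<open>x n\<close>, \<open>y n\<close>, \<open>z n\<close> are the edge resistances of the star that is
  electrically equivalent to the triangle with conductances \<open>a n\<close>, \<open>b n\<close>, \<open>c n\<close>. Three
  such stars glued along a triangle of six vertices have, seen from the three corners, again the
  resistances of a star: the three inner edges form a triangle with resistances \<open>x + y\<close>,
  \<open>y + z\<close>, \<open>z + x\<close>, and \<open>phi\<close> is the star resistance of that triangle, added in series
  to the outer leg. So the recursion says that every level is the trace of the next one.

  Only a degenerate family of initial data admits an infinite positive continuation because the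
  passage from level \<open>n\<close> to level \<open>n - 1\<close> contracts differences relative to the size of the
  triple, so that they grow in the direction of the construction. If \<open>x \<ge> y > z\<close>, then each
  level keeps at least \<open>3/4\<close> of the difference of the two smaller resistances, but at most \<open>2/3\<close>
  of the sum of all three; eventually the difference would exceed the sum
  (\<open>orbit_middle_not_above_smallest\<close>). Hence the two smaller resistances agree.

  If all three agree, the recursion is multiplication by \<open>3/5\<close> and the form is the standard one.
  This uses that two cells of the same level share at most one vertex, so that the sum over
  neighbouring points is a sum over cells (\<open>sum_adj_eq_cell_form\<close>).

  If \<open>x > y = z\<close>, then \<open>x n\<close> is of order \<open>(2/3)\<^sup>n\<close> by the bounds on differences and sums.
  The ratio \<open>y n / x n\<close> tends to \<open>0\<close> geometrically, so the recursion for \<open>y\<close> is a summable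
  perturbation of halving, and \<open>y n\<close> is of order \<open>(1/2)\<^sup>n\<close> (\<open>orbit_anisotropic_bounds\<close>).
  The conductances then have orders \<open>2\<^sup>n\<close> and \<open>(3/2)\<^sup>n = 2\<^sup>n (3/4)\<^sup>n\<close>, with constants
  uniform in \<open>n\<close>. Since the discrete energies increase with \<open>n\<close> (\<open>energy_n_mono\<close>), the limit
  is a supremum and inherits the comparison level by level.
\<close>

section \<open>Star resistances along the recursion\<close>

text \<open>The positivity and the recursion are required at every level alike, which makes the notion
  invariant under all permutations of the three sequences; the arguments below treat one ordering
  of the resistances and obtain the others from \<open>orbit_rotate\<close> and \<open>orbit_swap\<close>.\<close>

definition orbit :: "(nat \<Rightarrow> real) \<Rightarrow> (nat \<Rightarrow> real) \<Rightarrow> (nat \<Rightarrow> real) \<Rightarrow> bool" where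
  "orbit x y z \<longleftrightarrow> (\<forall>n. x n > 0 \<and> y n > 0 \<and> z n > 0 \<and>
     x n = x (Suc n) + phi (x (Suc n)) (y (Suc n)) (z (Suc n)) \<and>
     y n = y (Suc n) + phi (y (Suc n)) (z (Suc n)) (x (Suc n)) \<and>
     z n = z (Suc n) + phi (z (Suc n)) (x (Suc n)) (y (Suc n)))"

lemma phi_commute: "phi x y z = phi x z y"
  by (simp add: phi_def ac_simps)

lemma orbit_rotate: "orbit x y z \<Longrightarrow> orbit y z x"
  unfolding orbit_def by blast

lemma orbit_swap: "orbit x y z \<Longrightarrow> orbit x z y"
  unfolding orbit_def by (metis phi_commute)

lemma orbit_rec_construction:
  assumes "a0 > 0" "b0 > 0" "c0 > 0" "rec_construction a0 b0 c0 x y z"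
  shows "orbit x y z"
proof -
  have \<eta>: "a0 * b0 + b0 * c0 + c0 * a0 > 0"
    using assms by (simp add: add_pos_pos)
  have 0: "x 0 > 0" "y 0 > 0" "z 0 > 0"
    using assms \<eta> by (simp_all add: rec_construction_def Let_def)
  have S: "x (Suc n) > 0 \<and> y (Suc n) > 0 \<and> z (Suc n) > 0 \<and>
     x n = x (Suc n) + phi (x (Suc n)) (y (Suc n)) (z (Suc n)) \<and>
     y n = y (Suc n) + phi (y (Suc n)) (z (Suc n)) (x (Suc n)) \<and>
     z n = z (Suc n) + phi (z (Suc n)) (x (Suc n)) (y (Suc n))" for n
    using assms(4)[unfolded rec_construction_def, THEN conjunct2, THEN spec, of "Suc n"] by simp
  have "x n > 0 \<and> y n > 0 \<and> z n > 0" for n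
    using 0 S[of "n - 1"] by (cases n) auto
  then show ?thesis unfolding orbit_def using S by blast
qed

lemma orbit_pos:
  assumes "orbit x y z"
  shows "x n > 0" "y n > 0" "z n > 0"
  using assms unfolding orbit_def by blast+

lemma orbit_step:
  assumes "orbit x y z"
  shows "x n = x (Suc n) + phi (x (Suc n)) (y (Suc n)) (z (Suc n))"
    and "y n = y (Suc n) + phi (y (Suc n)) (z (Suc n)) (x (Suc n))"
    and "z n = z (Suc n) + phi (z (Suc n)) (x (Suc n)) (y (Suc n))"
  using assms unfolding orbit_def by blast+

lemma phi_diff:
  assumes "x > 0" "y > 0" "z > 0"
  shows "phi x y z - phi y z x = (x - y) * ((x + y) / (2 * (x + y + z)))"
proof -
  define s where "s = x + y + z"
  have s: "s > 0" "y + z + x = s" "x + y + z = s"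
    using assms by (simp_all add: s_def)
  show ?thesis unfolding phi_def s using s(1)
    by (simp add: divide_simps) (simp add: algebra_simps)
qed

lemma phi_sum:
  assumes "x > 0" "y > 0" "z > 0"
  shows "phi x y z + phi y z x + phi z x y =
    (x + y + z) / 2 + (x * y + y * z + z * x) / (2 * (x + y + z))"
proof -
  define s where "s = x + y + z"
  have s: "s > 0" "y + z + x = s" "z + x + y = s" "x + y + z = s"
    using assms by (simp_all add: s_def)
  have "phi x y z + phi y z x + phi z x y =
      ((x + y) * (x + z) + (y + z) * (y + x) + (z + x) * (z + y)) / (2 * s)"
    unfolding phi_def s by (simp add: add_divide_distrib)
  also have "(x + y) * (x + z) + (y + z) * (y + x) + (z + x) * (z + y) =
      s * s + (x * y + y * z + z * x)"
    unfolding s_def by (simp add: algebra_simps)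
  finally show ?thesis unfolding s using s(1) by (simp add: add_divide_distrib)
qed

text \<open>Differences renormalize by a scalar factor between \<open>1\<close> and \<open>3/2\<close>. Its positivity
  makes the ordering of the three resistances the same at all levels, and bounds on it control the
  growth of the differences.\<close>

lemma orbit_diff:
  assumes "orbit x y z"
  shows "x n - y n = (x (Suc n) - y (Suc n)) *
    (1 + (x (Suc n) + y (Suc n)) / (2 * (x (Suc n) + y (Suc n) + z (Suc n))))"
  using phi_diff[OF orbit_pos[OF assms, of "Suc n"]] orbit_step[OF assms, of n]
  by (simp add: algebra_simps)

lemma orbit_diff_pos_iff:
  assumes "orbit x y z"
  shows "x n > y n \<longleftrightarrow> x 0 > y 0"
proof (induction n)
  case (Suc n)
  let ?f = "1 + (x (Suc n) + y (Suc n)) / (2 * (x (Suc n) + y (Suc n) + z (Suc n)))"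
  have "?f > 0"
    using orbit_pos[OF assms, of "Suc n"] by (simp add: add_pos_pos)
  then have "x n - y n > 0 \<longleftrightarrow> x (Suc n) - y (Suc n) > 0"
    unfolding orbit_diff[OF assms, of n] by (simp add: zero_less_mult_iff)
  with Suc show ?case by simp
qed simp

text \<open>The three \<open>phi\<close> terms add up to at least half of the sum of the resistances
  (\<open>phi_sum\<close>), so each level has at most two thirds of the total of the preceding one.\<close>

lemma orbit_sum_le:
  assumes "orbit x y z"
  shows "x n + y n + z n \<le> (2/3) ^ n * (x 0 + y 0 + z 0)"
proof (induction n)
  case (Suc n)
  note p = orbit_pos[OF assms, of "Suc n"]
  define q where "q = (x (Suc n) * y (Suc n) + y (Suc n) * z (Suc n) + z (Suc n) * x (Suc n)) /
      (2 * (x (Suc n) + y (Suc n) + z (Suc n)))"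
  have "q \<ge> 0"
    unfolding q_def using p by (intro divide_nonneg_nonneg add_nonneg_nonneg mult_nonneg_nonneg) auto
  moreover have "x n + y n + z n = (3/2) * (x (Suc n) + y (Suc n) + z (Suc n)) + q"
    using phi_sum[OF p, folded q_def] orbit_step[OF assms, of n] by (simp add: field_simps)
  ultimately have "x (Suc n) + y (Suc n) + z (Suc n) \<le> (2/3) * (x n + y n + z n)"
    by (simp add: field_simps)
  also have "\<dots> \<le> (2/3) * ((2/3) ^ n * (x 0 + y 0 + z 0))"
    using Suc by (intro mult_left_mono) auto
  finally show ?case by simp
qed simp

text \<open>The two smallest resistances make up at most two thirds of the total, so the factor for
  their difference is at most \<open>4/3\<close>. This is less than \<open>3/2\<close>, the rate at which the total decays:
  a nonzero difference at level \<open>0\<close> would be at most \<open>(8/9)\<^sup>n\<close> times the total for all \<open>n\<close>.\<close>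

lemma orbit_middle_not_above_smallest:
  assumes "orbit x y z" "x 0 \<ge> y 0"
  shows "\<not> y 0 > z 0"
proof
  assume yz: "y 0 > z 0"
  have 1: "y n > z n" "x n \<ge> y n" for n
    using orbit_diff_pos_iff[OF orbit_rotate[OF assms(1)], of n] yz
      orbit_diff_pos_iff[OF orbit_swap[OF orbit_rotate[OF assms(1)]], of n]
      assms(2) by auto
  have 2: "y 0 - z 0 \<le> (4/3) ^ n * (y n - z n)" for n
  proof (induction n)
    case (Suc n)
    have "(y (Suc n) + z (Suc n)) / (2 * (y (Suc n) + z (Suc n) + x (Suc n))) \<le> 1/3"
      using orbit_pos[OF assms(1), of "Suc n"] 1[of "Suc n"] by (simp add: field_simps)
    then have "y n - z n \<le> (y (Suc n) - z (Suc n)) * (4/3)"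
      unfolding orbit_diff[OF orbit_rotate[OF assms(1)], of n]
      using 1(1)[of "Suc n"] by (intro mult_left_mono) auto
    then have "(4/3) ^ n * (y n - z n) \<le> (4/3) ^ n * ((y (Suc n) - z (Suc n)) * (4/3))"
      by (rule mult_left_mono) simp
    also have "\<dots> = (4/3) ^ Suc n * (y (Suc n) - z (Suc n))"
      by simp
    finally show ?case using Suc by linarith
  qed simp
  have "y 0 - z 0 \<le> (8/9) ^ n * (x 0 + y 0 + z 0)" for n
  proof -
    have "y n - z n \<le> (2/3) ^ n * (x 0 + y 0 + z 0)"
      using orbit_sum_le[OF assms(1), of n] orbit_pos[OF assms(1), of n] by linarith
    then have "(4/3) ^ n * (y n - z n) \<le> (4/3) ^ n * ((2/3) ^ n * (x 0 + y 0 + z 0))"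
      by (rule mult_left_mono) simp
    also have "\<dots> = (8/9) ^ n * (x 0 + y 0 + z 0)"
      by (simp add: power_mult_distrib[symmetric] mult.assoc[symmetric])
    finally show ?thesis using 2[of n] by linarith
  qed
  moreover have "(\<lambda>n. (8/9::real) ^ n * (x 0 + y 0 + z 0)) \<longlonglongrightarrow> 0 * (x 0 + y 0 + z 0)"
    by (intro tendsto_intros LIMSEQ_realpow_zero) auto
  ultimately have "y 0 - z 0 \<le> 0 * (x 0 + y 0 + z 0)"
    by (intro LIMSEQ_le_const) auto
  with yz show False by simp
qed

text \<open>The preceding lemma, applied to all six orderings of the resistances.\<close>

lemma orbit_cases:
  assumes "orbit x y z"
  shows "(x 0 = y 0 \<and> y 0 = z 0) \<or> (x 0 > y 0 \<and> y 0 = z 0) \<or>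
    (y 0 > z 0 \<and> z 0 = x 0) \<or> (z 0 > x 0 \<and> x 0 = y 0)"
proof -
  note o1 = assms
  note o2 = orbit_rotate[OF o1]
  note o3 = orbit_rotate[OF o2]
  have "x 0 < y 0 \<or> y 0 \<le> z 0" "y 0 < z 0 \<or> z 0 \<le> x 0" "z 0 < x 0 \<or> x 0 \<le> y 0"
    "x 0 < z 0 \<or> z 0 \<le> y 0" "y 0 < x 0 \<or> x 0 \<le> z 0" "z 0 < y 0 \<or> y 0 \<le> x 0"
    using orbit_middle_not_above_smallest[OF o1] orbit_middle_not_above_smallest[OF o2]
      orbit_middle_not_above_smallest[OF o3] orbit_middle_not_above_smallest[OF orbit_swap[OF o1]]
      orbit_middle_not_above_smallest[OF orbit_swap[OF o2]] orbit_middle_not_above_smallest[OF orbit_swap[OF o3]]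
    by (meson not_less)+
  then show ?thesis by (smt (verit))
qed

lemma orbit_eq:
  assumes "orbit x y z" "x 0 = y 0"
  shows "x n = y n"
  using orbit_diff_pos_iff[OF assms(1), of n]
    orbit_diff_pos_iff[OF orbit_swap[OF orbit_rotate[OF assms(1)]], of n] assms(2)
  by linarith

lemma three_fifths_over_two_thirds_power: "(3/5::real) ^ n / (2/3) ^ n = (9/10) ^ n"
  by (simp add: power_divide[symmetric])

text \<open>Each level keeps at least \<open>2/3\<close> of the difference \<open>x - y\<close>, which bounds \<open>x\<close> from
  below; the total bounds it from above at the same rate. For \<open>y\<close> the recursion is
  \<open>y (n - 1) = y n * (2 + 3 t) / (1 + 2 t)\<close> with \<open>t = y n / x n\<close>. The factor always lies between
  \<open>5/3\<close> and \<open>2\<close>. The first bound makes \<open>t\<close> decay like \<open>(9/10)\<^sup>n\<close>, and the factor differs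
  from \<open>2\<close> by a quantity of order \<open>t\<close>, so that \<open>2\<^sup>n y n\<close> stays bounded.\<close>

lemma orbit_anisotropic_bounds:
  assumes o: "orbit x y z" and xy: "x 0 > y 0" and yz: "y 0 = z 0"
  shows "\<exists>c C. c > 0 \<and> C > 0 \<and> (\<forall>n. c * (2/3) ^ n \<le> x n \<and> x n \<le> C * (2/3) ^ n \<and>
    c * (1/2) ^ n \<le> y n \<and> y n \<le> C * (1/2) ^ n)"
proof -
  have p: "x n > 0" "y n > 0" for n using orbit_pos[OF o] by auto
  have z: "z n = y n" for n using orbit_eq[OF orbit_rotate[OF o]] yz by simp
  have gt: "x n > y n" for n using orbit_diff_pos_iff[OF o] xy by simp
  define D where "D = x 0 - y 0"
  have D: "D > 0" using xy by (simp add: D_def)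
  have x_lower: "D * (2/3) ^ n \<le> x n" for n
  proof -
    have "D \<le> (3/2) ^ n * (x n - y n)"
    proof (induction n)
      case (Suc n)
      have "(x (Suc n) + y (Suc n)) / (2 * (x (Suc n) + y (Suc n) + z (Suc n))) \<le> 1/2"
        using orbit_pos[OF o, of "Suc n"] by (simp add: field_simps)
      then have "x n - y n \<le> (x (Suc n) - y (Suc n)) * (3/2)"
        unfolding orbit_diff[OF o, of n]
        using gt[of "Suc n"] by (intro mult_left_mono) auto
      then have "(3/2) ^ n * (x n - y n) \<le> (3/2) ^ n * ((x (Suc n) - y (Suc n)) * (3/2))"
        by (rule mult_left_mono) simp
      also have "\<dots> = (3/2) ^ Suc n * (x (Suc n) - y (Suc n))"
        by simp
      finally show ?case using Suc by linarith
    qed (simp add: D_def)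
    also have "\<dots> \<le> (3/2) ^ n * x n"
      using p(2)[of n] by (intro mult_left_mono) auto
    finally show ?thesis by (simp add: power_divide field_simps)
  qed
  have x_upper: "x n \<le> (x 0 + y 0 + z 0) * (2/3) ^ n" for n
    using orbit_sum_le[OF o, of n] orbit_pos[OF o, of n] by (simp add: mult.commute)
  have y_step: "y n = y (Suc n) * ((2 * x (Suc n) + 3 * y (Suc n)) / (x (Suc n) + 2 * y (Suc n)))" for n
  proof -
    define s where "s = x (Suc n) + 2 * y (Suc n)"
    have s: "s > 0" "y (Suc n) + y (Suc n) + x (Suc n) = s" "x (Suc n) + 2 * y (Suc n) = s"
      using p[of "Suc n"] by (simp_all add: s_def)
    show ?thesis
      unfolding orbit_step(2)[OF o, of n] phi_def z s using s(1)
      by (simp add: divide_simps) (simp add: s_def algebra_simps)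
  qed
  have y_decay: "y n \<le> (3/5) ^ n * y 0" for n
  proof (induction n)
    case (Suc n)
    have "5/3 \<le> (2 * x (Suc n) + 3 * y (Suc n)) / (x (Suc n) + 2 * y (Suc n))"
      using p[of "Suc n"] gt[of "Suc n"] by (simp add: field_simps)
    then have "y (Suc n) * (5/3) \<le> y n"
      unfolding y_step[of n] using p(2)[of "Suc n"] by (intro mult_left_mono) auto
    with Suc show ?case by simp
  qed simp
  have y_lower: "y 0 * (1/2) ^ n \<le> y n" for n
  proof (induction n)
    case (Suc n)
    have "(2 * x (Suc n) + 3 * y (Suc n)) / (x (Suc n) + 2 * y (Suc n)) \<le> 2"
      using p[of "Suc n"] by (simp add: field_simps)
    then have "y n \<le> y (Suc n) * 2"
      unfolding y_step[of n] using p(2)[of "Suc n"] by (intro mult_left_mono) auto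
    with Suc show ?case by simp
  qed simp
  define A where "A = y 0 / D"
  have A: "A > 0" using p D by (simp add: A_def)
  have ratio: "y n / x n \<le> A * (9/10) ^ n" for n
  proof -
    have "y n / x n \<le> ((3/5) ^ n * y 0) / (D * (2/3) ^ n)"
      using y_decay[of n] x_lower[of n] p(2)[of 0] D by (intro frac_le) auto
    also have "\<dots> = A * ((3/5) ^ n / (2/3) ^ n)"
      by (simp add: A_def)
    finally show ?thesis unfolding three_fifths_over_two_thirds_power .
  qed
  \<comment> \<open>Induction form of \<open>2\<^sup>n y n \<le> y 0 * exp ((\<Sum>k=1..n. t k) / 2)\<close>. The exponent on the
    right increases by \<open>A (9/10)\<^sup>n / 2\<close> from level \<open>n\<close> to level \<open>n + 1\<close>, which dominates \<open>t / 2\<close>.\<close>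
  have y_exp: "2 ^ n * y n \<le> y 0 * exp (5 * A - 5 * A * (9/10) ^ n)" for n
  proof (induction n)
    case (Suc n)
    define t where "t = y (Suc n) / x (Suc n)"
    have t: "t > 0" "t \<le> A * (9/10) ^ Suc n"
      using p ratio[of "Suc n"] by (simp_all add: t_def)
    have yt: "y (Suc n) = t * x (Suc n)" using p(1)[of "Suc n"] by (simp add: t_def)
    have "y (Suc n) * ((2 * x (Suc n) + 3 * y (Suc n)) / (x (Suc n) + 2 * y (Suc n))) =
        y (Suc n) * ((2 + 3 * t) / (1 + 2 * t))"
    proof -
      have num: "2 * x (Suc n) + 3 * y (Suc n) = x (Suc n) * (2 + 3 * t)"
        and den: "x (Suc n) + 2 * y (Suc n) = x (Suc n) * (1 + 2 * t)"
        unfolding yt by (simp_all add: algebra_simps)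
      have "x (Suc n) \<noteq> 0" using p(1)[of "Suc n"] by simp
      then show ?thesis unfolding num den by simp
    qed
    then have yn: "y n = y (Suc n) * ((2 + 3 * t) / (1 + 2 * t))"
      using y_step[of n] by (rule trans[rotated])
    have "2 / (1 + t / 2) \<le> (2 + 3 * t) / (1 + 2 * t)"
      using t(1) by (simp add: field_simps)
    then have "y (Suc n) * (2 / (1 + t / 2)) \<le> y n"
      unfolding yn using p(2)[of "Suc n"] by (intro mult_left_mono) auto
    then have "2 * y (Suc n) \<le> y n * (1 + t / 2)"
      using t(1) by (simp add: field_simps)
    also have "\<dots> \<le> y n * exp (t / 2)"
      using p(2)[of n] exp_ge_add_one_self[of "t / 2"] by (intro mult_left_mono) auto
    also have "\<dots> \<le> y n * exp (5 * A * (9/10) ^ n - 5 * A * (9/10) ^ Suc n)"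
    proof -
      have "0 < A * (9/10) ^ n" using A by simp
      then have "t / 2 \<le> 5 * A * (9/10) ^ n - 5 * A * (9/10) ^ Suc n"
        using t(2) by simp
      then show ?thesis using p(2)[of n] by (intro mult_left_mono) auto
    qed
    finally have "2 ^ n * (2 * y (Suc n)) \<le>
        2 ^ n * (y n * exp (5 * A * (9/10) ^ n - 5 * A * (9/10) ^ Suc n))"
      by (rule mult_left_mono) simp
    also have "\<dots> \<le> (y 0 * exp (5 * A - 5 * A * (9/10) ^ n)) *
        exp (5 * A * (9/10) ^ n - 5 * A * (9/10) ^ Suc n)"
      using mult_right_mono[OF Suc, of "exp (5 * A * (9/10) ^ n - 5 * A * (9/10) ^ Suc n)"]
      by (simp add: mult.assoc)
    also have "\<dots> = y 0 * exp (5 * A - 5 * A * (9/10) ^ Suc n)"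
      by (simp add: mult.assoc exp_add[symmetric])
    finally show ?case by (simp add: mult.assoc)
  qed simp
  have y_upper: "y n \<le> y 0 * exp (5 * A) * (1/2) ^ n" for n
  proof -
    have "2 ^ n * y n \<le> y 0 * exp (5 * A)"
      using y_exp[of n] A p(2)[of 0]
      by (rule_tac order_trans[OF y_exp[of n]]) simp
    then show ?thesis by (simp add: power_divide field_simps)
  qed
  define c where "c = min D (y 0)"
  define C where "C = max (x 0 + y 0 + z 0) (y 0 * exp (5 * A))"
  have cC: "c > 0" "C > 0" using D orbit_pos[OF o, of 0] by (simp_all add: c_def C_def less_max_iff_disj)
  have "c * (2/3) ^ n \<le> D * (2/3) ^ n" "c * (1/2) ^ n \<le> y 0 * (1/2) ^ n"
    "(x 0 + y 0 + z 0) * (2/3) ^ n \<le> C * (2/3) ^ n"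
    "y 0 * exp (5 * A) * (1/2) ^ n \<le> C * (1/2) ^ n" for n
    by (intro mult_right_mono; simp add: c_def C_def)+
  then show ?thesis
    using x_lower x_upper y_lower y_upper cC by (meson order_trans)
qed

text \<open>For \<open>y = z\<close> the conductances are \<open>x / (y (2 x + y))\<close> and \<open>1 / (2 x + y)\<close>, which for
  \<open>y < x\<close> lie within constant factors of \<open>1 / y\<close> and \<open>1 / x\<close>.\<close>

lemma orbit_anisotropic_conductances:
  assumes o: "orbit x y z" and xy: "x 0 > y 0" and yz: "y 0 = z 0"
  shows "\<exists>c C. c > 0 \<and> C > 0 \<and> (\<forall>n. let r = x n * y n + y n * z n + z n * x n in
    c * 2 ^ n \<le> x n / r \<and> x n / r \<le> C * 2 ^ n \<and>
    c * (3/2) ^ n \<le> y n / r \<and> y n / r \<le> C * (3/2) ^ n \<and>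
    c * (3/2) ^ n \<le> z n / r \<and> z n / r \<le> C * (3/2) ^ n)"
proof -
  obtain c C where cC: "c > 0" "C > 0"
    and B: "\<And>n. c * (2/3) ^ n \<le> x n" "\<And>n. x n \<le> C * (2/3) ^ n"
      "\<And>n. c * (1/2) ^ n \<le> y n" "\<And>n. y n \<le> C * (1/2) ^ n"
    using orbit_anisotropic_bounds[OF assms] by metis
  have p: "x n > 0" "y n > 0" for n using orbit_pos[OF o] by auto
  have z: "z n = y n" for n using orbit_eq[OF orbit_rotate[OF o]] yz by simp
  have gt: "x n > y n" for n using orbit_diff_pos_iff[OF o] xy by simp
  have "1 / (3 * C) * 2 ^ n \<le> x n / (x n * y n + y n * z n + z n * x n) \<and>
      x n / (x n * y n + y n * z n + z n * x n) \<le> 1 / c * 2 ^ n \<and>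
      1 / (3 * C) * (3/2) ^ n \<le> y n / (x n * y n + y n * z n + z n * x n) \<and>
      y n / (x n * y n + y n * z n + z n * x n) \<le> 1 / c * (3/2) ^ n" for n
  proof -
    have pn: "x n > 0" "y n > 0" by (fact p)+
    have r: "x n * y n + y n * z n + z n * x n = y n * (2 * x n + y n)"
      by (simp add: z algebra_simps)
    have yr: "y n / (x n * y n + y n * z n + z n * x n) = 1 / (2 * x n + y n)"
      unfolding r using pn by simp
    have "1 / (3 * (C * (1/2) ^ n)) \<le> 1 / (3 * y n)"
      using B(4)[of n] pn by (intro frac_le) auto
    also have "\<dots> \<le> x n / (y n * (2 * x n + y n))"
      using pn gt[of n] by (simp add: divide_simps)
    finally have 1: "1 / (3 * (C * (1/2) ^ n)) \<le> x n / (y n * (2 * x n + y n))" .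
    have "x n / (y n * (2 * x n + y n)) \<le> 1 / y n"
      using pn by (simp add: divide_simps)
    also have "\<dots> \<le> 1 / (c * (1/2) ^ n)"
      using B(3)[of n] pn cC by (intro frac_le) auto
    finally have 2: "x n / (y n * (2 * x n + y n)) \<le> 1 / (c * (1/2) ^ n)" .
    have 3: "1 / (3 * (C * (2/3) ^ n)) \<le> 1 / (2 * x n + y n)"
      using B(2)[of n] pn gt[of n] by (intro frac_le) auto
    have 4: "1 / (2 * x n + y n) \<le> 1 / (c * (2/3) ^ n)"
      using B(1)[of n] pn cC by (intro frac_le) auto
    show ?thesis
      unfolding yr unfolding r using 1 2 3 4 by (simp add: power_divide)
  qed
  then show ?thesis
    unfolding Let_def z using cC
    by (intro exI[of _ "1 / (3 * C)"] exI[of _ "1 / c"]) (simp add: z)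
qed

section \<open>Monotonicity of the discrete energies\<close>

text \<open>Energy of the potentials \<open>p\<close>, \<open>q\<close>, \<open>r\<close> on the triangle that is equivalent to the star
  with leg resistances \<open>x\<close>, \<open>y\<close>, \<open>z\<close>.\<close>

definition star_form :: "real \<Rightarrow> real \<Rightarrow> real \<Rightarrow> real \<Rightarrow> real \<Rightarrow> real \<Rightarrow> real" where
  "star_form x y z p q r =
     (x * (q - r)\<^sup>2 + y * (p - r)\<^sup>2 + z * (p - q)\<^sup>2) / (x * y + y * z + z * x)"

text \<open>The star with potential \<open>w\<close> at its centre has the energy on the left. The square on the
  right vanishes exactly when \<open>w\<close> is the equilibrium potential of the centre, so the energy of the
  triangle is the minimum of the energy of the star over \<open>w\<close>.\<close>

lemma star_form_defect:
  assumes "x > 0" "y > 0" "z > 0"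
  shows "(p - w)\<^sup>2 / x + (q - w)\<^sup>2 / y + (r - w)\<^sup>2 / z = star_form x y z p q r +
    (y * z * (p - w) + z * x * (q - w) + x * y * (r - w))\<^sup>2 / (x * y * z * (x * y + y * z + z * x))"
proof -
  define d where "d = x * y + y * z + z * x"
  have d: "d > 0" using assms by (simp add: d_def add_pos_pos)
  define P Q R where "P = p - w" and "Q = q - w" and "R = r - w"
  have diffs: "q - r = Q - R" "p - r = P - R" "p - q = P - Q"
    by (simp_all add: P_def Q_def R_def)
  have "(y * z * P\<^sup>2 + z * x * Q\<^sup>2 + x * y * R\<^sup>2) * d =
      x * y * z * (x * (Q - R)\<^sup>2 + y * (P - R)\<^sup>2 + z * (P - Q)\<^sup>2) +
      (y * z * P + z * x * Q + x * y * R)\<^sup>2"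
    unfolding d_def by algebra
  moreover have "N / k = M / d + S / (k * d)" if "N * d = k * M + S" "k > 0" for N M S k :: real
  proof -
    have "N / k = (N * d) / (k * d)" using d by simp
    then show ?thesis unfolding that(1) using that(2) d by (simp add: add_divide_distrib)
  qed
  ultimately have "(y * z * P\<^sup>2 + z * x * Q\<^sup>2 + x * y * R\<^sup>2) / (x * y * z) =
      (x * (Q - R)\<^sup>2 + y * (P - R)\<^sup>2 + z * (P - Q)\<^sup>2) / d +
      (y * z * P + z * x * Q + x * y * R)\<^sup>2 / (x * y * z * d)"
    using assms by simp
  moreover have "P\<^sup>2 / x + Q\<^sup>2 / y + R\<^sup>2 / z =
      (y * z * P\<^sup>2 + z * x * Q\<^sup>2 + x * y * R\<^sup>2) / (x * y * z)"
    using assms by (simp add: field_simps)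
  ultimately show ?thesis
    unfolding star_form_def diffs P_def[symmetric] Q_def[symmetric] R_def[symmetric]
      d_def[symmetric] by simp
qed

lemma star_form_le:
  assumes "x > 0" "y > 0" "z > 0"
  shows "star_form x y z p q r \<le> (p - w)\<^sup>2 / x + (q - w)\<^sup>2 / y + (r - w)\<^sup>2 / z"
  unfolding star_form_defect[OF assms] using assms by (simp add: add_nonneg_nonneg)

lemma star_form_attained:
  assumes "x > 0" "y > 0" "z > 0"
  shows "\<exists>w. star_form x y z p q r = (p - w)\<^sup>2 / x + (q - w)\<^sup>2 / y + (r - w)\<^sup>2 / z"
proof -
  define d where "d = x * y + y * z + z * x"
  have d: "d > 0" using assms by (simp add: d_def add_pos_pos)
  define w where "w = (y * z * p + z * x * q + x * y * r) / d"
  have "w * d = y * z * p + z * x * q + x * y * r" using d by (simp add: w_def)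
  then have "y * z * (p - w) + z * x * (q - w) + x * y * (r - w) = 0"
    unfolding d_def by (simp add: algebra_simps)
  then show ?thesis
    by (intro exI[of _ w]) (simp add: star_form_defect[OF assms])
qed

text \<open>Two resistances in series: the potential \<open>m\<close> at the middle node can only raise the energy
  above that of the combined resistor.\<close>

lemma series_le:
  fixes x y s m t :: real
  assumes "x > 0" "y > 0"
  shows "(s - t)\<^sup>2 / (x + y) \<le> (s - m)\<^sup>2 / x + (m - t)\<^sup>2 / y"
proof -
  have "(s - m)\<^sup>2 / x + (m - t)\<^sup>2 / y = (y * (s - m)\<^sup>2 + x * (m - t)\<^sup>2) * (x + y) / (x * y * (x + y))"
  proof -
    have "x + y \<noteq> 0" using assms by auto
    moreover have "(s - m)\<^sup>2 / x + (m - t)\<^sup>2 / y = (y * (s - m)\<^sup>2 + x * (m - t)\<^sup>2) / (x * y)"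
      using assms by (simp add: field_simps)
    ultimately show ?thesis by simp
  qed
  also have "(y * (s - m)\<^sup>2 + x * (m - t)\<^sup>2) * (x + y) =
      x * y * (s - t)\<^sup>2 + (y * (s - m) - x * (m - t))\<^sup>2"
    by algebra
  also have "x * y * (s - t)\<^sup>2 / (x * y * (x + y)) \<le>
      (x * y * (s - t)\<^sup>2 + (y * (s - m) - x * (m - t))\<^sup>2) / (x * y * (x + y))"
    using assms by (intro divide_right_mono) auto
  finally show ?thesis using assms by simp
qed

lemma phi_pos:
  assumes "x > 0" "y > 0" "z > 0"
  shows "phi x y z > 0"
  using assms by (simp add: phi_def)

text \<open>The star with resistances \<open>phi\<close> is equivalent to the triangle whose sides have the resistances
  \<open>x + y\<close>, \<open>y + z\<close>, \<open>z + x\<close>.\<close>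

lemma star_form_phi:
  assumes "x > 0" "y > 0" "z > 0"
  shows "star_form (phi x y z) (phi y z x) (phi z x y) p q r =
    (q - r)\<^sup>2 / (y + z) + (p - r)\<^sup>2 / (x + z) + (p - q)\<^sup>2 / (x + y)"
proof -
  define s where "s = x + y + z"
  have s: "s > 0" "y + z + x = s" "z + x + y = s" "x + y + z = s"
    using assms by (simp_all add: s_def)
  define f g h where "f = y + z" and "g = x + z" and "h = x + y"
  have pos: "f > 0" "g > 0" "h > 0" using assms by (simp_all add: f_def g_def h_def)
  have ph: "phi x y z = h * g / (2 * s)" "phi y z x = f * h / (2 * s)" "phi z x y = g * f / (2 * s)"
    unfolding phi_def s f_def g_def h_def by (simp_all add: add.commute)
  have "phi x y z * phi y z x + phi y z x * phi z x y + phi z x y * phi x y z =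
      f * g * h * (f + g + h) / (2 * s)\<^sup>2"
    unfolding ph by (simp add: power2_eq_square add_divide_distrib algebra_simps)
  also have "f + g + h = 2 * s"
    by (simp add: f_def g_def h_def s_def)
  finally have den: "phi x y z * phi y z x + phi y z x * phi z x y + phi z x y * phi x y z =
      f * g * h / (2 * s)"
    by (simp add: power2_eq_square)
  have "star_form (phi x y z) (phi y z x) (phi z x y) p q r =
      (h * g * (q - r)\<^sup>2 + f * h * (p - r)\<^sup>2 + g * f * (p - q)\<^sup>2) / (f * g * h)"
    unfolding star_form_def den unfolding ph using s(1) pos
    by (simp add: add_divide_distrib[symmetric])
  also have "\<dots> = (q - r)\<^sup>2 / f + (p - r)\<^sup>2 / g + (p - q)\<^sup>2 / h"
    using pos by (simp add: field_simps)
  finally show ?thesis unfolding f_def g_def h_def .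
qed

text \<open>One step of refinement within one cell. Replace the three small triangles by stars with
  centres \<open>w1\<close>, \<open>w2\<close>, \<open>w3\<close>, eliminate the midpoints \<open>m12\<close>, \<open>m13\<close>, \<open>m23\<close> by the series law,
  replace the resulting triangle of centres by a star with centre \<open>w\<close>, and eliminate the
  old centres by the series law. Every step can only lower the energy, and it ends with
  the energy of the large star.\<close>

lemma star_form_renormalize_le:
  assumes "x > 0" "y > 0" "z > 0"
  shows "star_form (x + phi x y z) (y + phi y z x) (z + phi z x y) p1 p2 p3 \<le>
    star_form x y z p1 m12 m13 + star_form x y z m12 p2 m23 + star_form x y z m13 m23 p3"
proof -
  note ph = phi_pos[OF assms] phi_pos[OF assms(2,3,1)] phi_pos[OF assms(3,1,2)]
  obtain w1 where w1: "star_form x y z p1 m12 m13 = (p1 - w1)\<^sup>2 / x + (m12 - w1)\<^sup>2 / y + (m13 - w1)\<^sup>2 / z"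
    using star_form_attained[OF assms] by blast
  obtain w2 where w2: "star_form x y z m12 p2 m23 = (m12 - w2)\<^sup>2 / x + (p2 - w2)\<^sup>2 / y + (m23 - w2)\<^sup>2 / z"
    using star_form_attained[OF assms] by blast
  obtain w3 where w3: "star_form x y z m13 m23 p3 = (m13 - w3)\<^sup>2 / x + (m23 - w3)\<^sup>2 / y + (p3 - w3)\<^sup>2 / z"
    using star_form_attained[OF assms] by blast
  obtain w where w: "star_form (phi x y z) (phi y z x) (phi z x y) w1 w2 w3 =
      (w1 - w)\<^sup>2 / phi x y z + (w2 - w)\<^sup>2 / phi y z x + (w3 - w)\<^sup>2 / phi z x y"
    using star_form_attained[OF ph] by blast
  have "star_form (x + phi x y z) (y + phi y z x) (z + phi z x y) p1 p2 p3 \<le>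
      (p1 - w)\<^sup>2 / (x + phi x y z) + (p2 - w)\<^sup>2 / (y + phi y z x) + (p3 - w)\<^sup>2 / (z + phi z x y)"
    using assms ph by (intro star_form_le) auto
  also have "\<dots> \<le> ((p1 - w1)\<^sup>2 / x + (w1 - w)\<^sup>2 / phi x y z) +
      ((p2 - w2)\<^sup>2 / y + (w2 - w)\<^sup>2 / phi y z x) + ((p3 - w3)\<^sup>2 / z + (w3 - w)\<^sup>2 / phi z x y)"
    using assms ph by (intro add_mono series_le) auto
  also have "\<dots> = (p1 - w1)\<^sup>2 / x + (p2 - w2)\<^sup>2 / y + (p3 - w3)\<^sup>2 / z +
      ((w2 - w3)\<^sup>2 / (y + z) + (w1 - w3)\<^sup>2 / (x + z) + (w1 - w2)\<^sup>2 / (x + y))"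
    using w unfolding star_form_phi[OF assms] by simp
  also have "\<dots> \<le> (p1 - w1)\<^sup>2 / x + (p2 - w2)\<^sup>2 / y + (p3 - w3)\<^sup>2 / z +
      (((w3 - m23)\<^sup>2 / y + (m23 - w2)\<^sup>2 / z) + ((w3 - m13)\<^sup>2 / x + (m13 - w1)\<^sup>2 / z) +
       ((w2 - m12)\<^sup>2 / x + (m12 - w1)\<^sup>2 / y))"
    using assms series_le[of y z w3 w2 m23] series_le[of x z w3 w1 m13] series_le[of x y w2 w1 m12]
    by (intro add_mono) (auto simp: power2_commute)
  also have "\<dots> = star_form x y z p1 m12 m13 + star_form x y z m12 p2 m23 + star_form x y z m13 m23 p3"
    unfolding w1 w2 w3 by (simp add: power2_commute)
  finally show ?thesis .
qed

text \<open>The common shape of all discrete forms: one set of three conductances used in every cell of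
  level \<open>n\<close>. The energies, the standard form and the anisotropic forms differ only in the
  conductances.\<close>

definition cell_form :: "real \<Rightarrow> real \<Rightarrow> real \<Rightarrow> nat \<Rightarrow> (complex \<Rightarrow> real) \<Rightarrow> real" where
  "cell_form a b c n u = (\<Sum>\<omega>\<in>W n.
     a * (u (Fw \<omega> (vtx 2)) - u (Fw \<omega> (vtx 3)))\<^sup>2 +
     b * (u (Fw \<omega> (vtx 1)) - u (Fw \<omega> (vtx 3)))\<^sup>2 +
     c * (u (Fw \<omega> (vtx 1)) - u (Fw \<omega> (vtx 2)))\<^sup>2)"

text \<open>Words are extended at the end, since the cell of \<open>\<omega>\<close> is subdivided into the cells of
  \<open>\<omega> @ [i]\<close>.\<close>

lemma W_Suc: "W (Suc n) = (\<lambda>(\<omega>, i). \<omega> @ [i]) ` (W n \<times> {1, 2, 3})"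
proof (intro equalityI subsetI)
  fix \<omega> assume "\<omega> \<in> W (Suc n)"
  then have \<omega>: "length \<omega> = Suc n" "set \<omega> \<subseteq> {1, 2, 3}" by (auto simp: W_def)
  then obtain \<tau> i where \<tau>: "\<omega> = \<tau> @ [i]" by (metis append_butlast_last_id length_0_conv nat.distinct(1))
  then have "(\<tau>, i) \<in> W n \<times> {1, 2, 3}" using \<omega> by (auto simp: W_def)
  then show "\<omega> \<in> (\<lambda>(\<omega>, i). \<omega> @ [i]) ` (W n \<times> {1, 2, 3})"
    unfolding \<tau> by force
qed (auto simp: W_def)

lemma sum_W_Suc: "(\<Sum>\<omega>\<in>W (Suc n). f \<omega>) = (\<Sum>\<omega>\<in>W n. f (\<omega> @ [1]) + f (\<omega> @ [2]) + f (\<omega> @ [3]))"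
proof -
  have "inj_on (\<lambda>(\<omega>, i). \<omega> @ [i]) (W n \<times> {1, 2, 3})" by (auto simp: inj_on_def)
  then have "(\<Sum>\<omega>\<in>W (Suc n). f \<omega>) = (\<Sum>(\<omega>, i)\<in>W n \<times> {1, 2, 3}. f (\<omega> @ [i]))"
    unfolding W_Suc by (simp add: sum.reindex case_prod_unfold)
  also have "\<dots> = (\<Sum>\<omega>\<in>W n. \<Sum>i\<in>{1, 2, 3}. f (\<omega> @ [i]))"
    by (rule sum.cartesian_product[symmetric])
  also have "\<dots> = (\<Sum>\<omega>\<in>W n. f (\<omega> @ [1]) + f (\<omega> @ [2]) + f (\<omega> @ [3]))"
    by (simp add: add.assoc)
  finally show ?thesis .
qed

lemma Fw_Cons: "Fw (i # \<omega>) p = F i (Fw \<omega> p)"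
  by (simp add: Fw_def)

lemma Fw_snoc: "Fw (\<omega> @ [i]) p = Fw \<omega> (F i p)"
  by (induction \<omega>) (simp_all add: Fw_def)

lemma F_vtx: "F i (vtx i) = vtx i"
  by (simp add: F_def)

lemma F_vtx_commute: "F i (vtx j) = F j (vtx i)"
  by (simp add: F_def field_simps)

lemma energy_n_cell_form:
  "energy_n x y z n u = (let r = x n * y n + y n * z n + z n * x n in
     cell_form (x n / r) (y n / r) (z n / r) n u)"
  by (simp add: energy_n_def cell_form_def Let_def)

lemma energy_n_star_form:
  "energy_n x y z n u = (\<Sum>\<omega>\<in>W n. star_form (x n) (y n) (z n)
     (u (Fw \<omega> (vtx 1))) (u (Fw \<omega> (vtx 2))) (u (Fw \<omega> (vtx 3))))"
  by (simp add: energy_n_def star_form_def Let_def add_divide_distrib)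

text \<open>The midpoint of the side joining the vertices \<open>i\<close> and \<open>j\<close> is both \<open>F i (vtx j)\<close> and
  \<open>F j (vtx i)\<close>, which is how the three small cells are glued in \<open>star_form_renormalize_le\<close>.\<close>

lemma energy_n_mono:
  assumes "orbit x y z"
  shows "incseq (\<lambda>n. energy_n x y z n u)"
proof (rule incseq_SucI)
  fix n
  define X Y Z where "X = x (Suc n)" and "Y = y (Suc n)" and "Z = z (Suc n)"
  have pos: "X > 0" "Y > 0" "Z > 0" using orbit_pos[OF assms] by (simp_all add: X_def Y_def Z_def)
  have xyz: "x n = X + phi X Y Z" "y n = Y + phi Y Z X" "z n = Z + phi Z X Y"
    unfolding X_def Y_def Z_def by (rule orbit_step[OF assms])+
  have "energy_n x y z n u \<le> (\<Sum>\<omega>\<in>W n.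
      star_form X Y Z (u (Fw \<omega> (vtx 1))) (u (Fw \<omega> (F 1 (vtx 2)))) (u (Fw \<omega> (F 1 (vtx 3)))) +
      star_form X Y Z (u (Fw \<omega> (F 1 (vtx 2)))) (u (Fw \<omega> (vtx 2))) (u (Fw \<omega> (F 2 (vtx 3)))) +
      star_form X Y Z (u (Fw \<omega> (F 1 (vtx 3)))) (u (Fw \<omega> (F 2 (vtx 3)))) (u (Fw \<omega> (vtx 3))))"
    unfolding energy_n_star_form xyz
    by (intro sum_mono star_form_renormalize_le pos)
  also have "\<dots> = energy_n x y z (Suc n) u"
    unfolding energy_n_star_form sum_W_Suc Fw_snoc F_vtx
      F_vtx_commute[of 2 1] F_vtx_commute[of 3 1] F_vtx_commute[of 3 2]
      X_def[symmetric] Y_def[symmetric] Z_def[symmetric] ..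
  finally show "energy_n x y z n u \<le> energy_n x y z (Suc n) u" .
qed

lemma lim_ennreal_incseq:
  assumes "incseq (f :: nat \<Rightarrow> real)"
  shows "lim (\<lambda>n. ennreal (f n)) = (SUP n. ennreal (f n))"
proof -
  have "incseq (\<lambda>n. ennreal (f n))"
    using assms by (auto simp: incseq_def intro: ennreal_leI)
  then show ?thesis by (intro limI LIMSEQ_SUP)
qed

lemma energy_SUP:
  assumes "orbit x y z"
  shows "energy x y z u = (SUP n. ennreal (energy_n x y z n u))"
  unfolding energy_def by (rule lim_ennreal_incseq[OF energy_n_mono[OF assms]])

section \<open>Each edge belongs to exactly one cell\<close>

text \<open>Barycentric coordinates of a point with respect to the second and third vertex. In these
  coordinates every \<open>F i\<close> prepends one binary digit.\<close>

definition bary2 :: "complex \<Rightarrow> real" where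
  "bary2 p = Re p - Im p / sqrt 3"

definition bary3 :: "complex \<Rightarrow> real" where
  "bary3 p = 2 * Im p / sqrt 3"

lemma vtx_3: "vtx 3 = Complex (1/2) (sqrt 3 / 2)"
proof -
  have "vtx 3 = cis (pi / 3)"
    by (simp add: vtx_def cis_conv_exp mult.commute)
  then show ?thesis by (simp add: complex_eq_iff cos_60 sin_60)
qed

lemma bary_vtx:
  assumes "i \<in> {1, 2, 3}"
  shows "bary2 (vtx i) = (if i = 2 then 1 else 0)" "bary3 (vtx i) = (if i = 3 then 1 else 0)"
  using assms vtx_3 by (auto simp: bary2_def bary3_def vtx_def)

lemma bary_diff: "bary2 (p - q) = bary2 p - bary2 q" "bary3 (p - q) = bary3 p - bary3 q"
  by (simp_all add: bary2_def bary3_def diff_divide_distrib right_diff_distrib)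

lemma bary_F: "bary2 (F i p) = (bary2 p + bary2 (vtx i)) / 2" "bary3 (F i p) = (bary3 p + bary3 (vtx i)) / 2"
  by (simp_all add: bary2_def bary3_def F_def add_divide_distrib diff_divide_distrib algebra_simps)

text \<open>The lower left corner of a cell lies in the triangle, but not on the side opposite to the
  first vertex. This strict inequality makes the address of the corner unique: in \<open>Fw_0_inj\<close>
  the first letter is \<open>2\<close> or \<open>3\<close> if the corresponding coordinate is at least \<open>1/2\<close>, and
  \<open>1\<close> otherwise, and the strictness excludes that both coordinates are at least \<open>1/2\<close>.\<close>

lemma bary_Fw_0:
  assumes "set \<omega> \<subseteq> {1, 2, 3}"
  shows "bary2 (Fw \<omega> 0) \<ge> 0 \<and> bary3 (Fw \<omega> 0) \<ge> 0 \<and> bary2 (Fw \<omega> 0) + bary3 (Fw \<omega> 0) < 1"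
  using assms
proof (induction \<omega>)
  case Nil
  then show ?case by (simp add: Fw_def bary2_def bary3_def)
next
  case (Cons i \<omega>)
  then show ?case
    by (simp only: Fw_Cons bary_F) (auto simp: bary_vtx[of i] field_simps)
qed

lemma Fw_0_inj:
  assumes "set \<omega> \<subseteq> {1, 2, 3}" "set \<tau> \<subseteq> {1, 2, 3}" "length \<omega> = length \<tau>" "Fw \<omega> 0 = Fw \<tau> 0"
  shows "\<omega> = \<tau>"
  using assms(3,1,2,4)
proof (induction \<omega> \<tau> rule: list_induct2)
  case (Cons i \<omega> j \<tau>)
  have ij: "i \<in> {1, 2, 3}" "j \<in> {1, 2, 3}" using Cons.prems by auto
  have F: "F i (Fw \<omega> 0) = F j (Fw \<tau> 0)"
    using Cons.prems(3) by (simp add: Fw_Cons)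
  have 2: "bary2 (Fw \<omega> 0) + bary2 (vtx i) = bary2 (Fw \<tau> 0) + bary2 (vtx j)"
    using arg_cong[OF F, of bary2] by (simp add: bary_F)
  have 3: "bary3 (Fw \<omega> 0) + bary3 (vtx i) = bary3 (Fw \<tau> 0) + bary3 (vtx j)"
    using arg_cong[OF F, of bary3] by (simp add: bary_F)
  have "i = j"
    using 2 3 bary_Fw_0[of \<omega>] bary_Fw_0[of \<tau>] Cons.prems(1,2) ij
    unfolding bary_vtx[OF ij(1)] bary_vtx[OF ij(2)]
    by (auto split: if_splits)
  then have "Fw \<omega> 0 = Fw \<tau> 0" using F injD[OF inj_F] by blast
  then show ?case using \<open>i = j\<close> Cons by simp
qed simp

lemma Fw_diff: "Fw \<omega> p - Fw \<omega> q = (p - q) / 2 ^ length \<omega>"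
proof (induction \<omega>)
  case (Cons i \<omega>)
  have "Fw (i # \<omega>) p - Fw (i # \<omega>) q = (Fw \<omega> p - Fw \<omega> q) / 2"
    by (simp add: Fw_Cons F_def field_simps)
  then show ?case using Cons by simp
qed (simp add: Fw_def)

definition edge_labels :: "(nat \<times> nat) set" where
  "edge_labels = {(2, 3), (3, 2), (1, 3), (3, 1), (1, 2), (2, 1)}"

lemma vtx_diff_inj:
  assumes "(i, j) \<in> edge_labels" "(k, l) \<in> edge_labels" "vtx i - vtx j = vtx k - vtx l"
  shows "i = k \<and> j = l"
proof -
  have ij: "i \<in> {1, 2, 3}" "j \<in> {1, 2, 3}" "k \<in> {1, 2, 3}" "l \<in> {1, 2, 3}"
    using assms(1,2) by (auto simp: edge_labels_def)
  have "bary2 (vtx i) - bary2 (vtx j) = bary2 (vtx k) - bary2 (vtx l)"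
    "bary3 (vtx i) - bary3 (vtx j) = bary3 (vtx k) - bary3 (vtx l)"
    using arg_cong[OF assms(3), of bary2] arg_cong[OF assms(3), of bary3] by (simp_all add: bary_diff)
  then show ?thesis
    unfolding bary_vtx[OF ij(1)] bary_vtx[OF ij(2)] bary_vtx[OF ij(3)] bary_vtx[OF ij(4)]
    using assms(1,2) by (auto simp: edge_labels_def split: if_splits)
qed

definition cell_edge :: "nat list \<times> nat \<times> nat \<Rightarrow> complex \<times> complex" where
  "cell_edge = (\<lambda>(\<omega>, i, j). (Fw \<omega> (vtx i), Fw \<omega> (vtx j)))"

text \<open>All cells of level \<open>n\<close> are translates of one triangle, whose six oriented edges are
  different vectors. An oriented edge therefore determines its labels, hence the translation, and
  the translation determines the word by \<open>Fw_0_inj\<close>.\<close>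

lemma inj_on_cell_edge: "inj_on cell_edge (W n \<times> edge_labels)"
proof (rule inj_onI)
  fix e e' assume e: "e \<in> W n \<times> edge_labels" "e' \<in> W n \<times> edge_labels"
    and "cell_edge e = cell_edge e'"
  moreover obtain \<omega> i j \<tau> k l where ee: "e = (\<omega>, i, j)" "e' = (\<tau>, k, l)"
    by (metis prod_cases3)
  ultimately have \<omega>: "\<omega> \<in> W n" "\<tau> \<in> W n" and L: "(i, j) \<in> edge_labels" "(k, l) \<in> edge_labels"
    and eq: "cell_edge (\<omega>, i, j) = cell_edge (\<tau>, k, l)"
    by auto
  have len: "length \<omega> = n" "length \<tau> = n" using \<omega> by (simp_all add: W_def)
  have E: "Fw \<omega> (vtx i) = Fw \<tau> (vtx k)" "Fw \<omega> (vtx j) = Fw \<tau> (vtx l)"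
    using eq by (simp_all add: cell_edge_def)
  then have "(vtx i - vtx j) / 2 ^ n = (vtx k - vtx l) / 2 ^ n"
    using Fw_diff[of \<omega> "vtx i" "vtx j"] Fw_diff[of \<tau> "vtx k" "vtx l"] len by simp
  then have "vtx i - vtx j = vtx k - vtx l" by simp
  then have ik: "i = k" "j = l" using vtx_diff_inj[OF L] by auto
  have "Fw \<omega> 0 = Fw \<tau> 0"
    using Fw_diff[of \<omega> "vtx i" 0] Fw_diff[of \<tau> "vtx i" 0] E(1) len ik by (simp add: algebra_simps)
  then show "e = e'"
    using Fw_0_inj[of \<omega> \<tau>] \<omega> ik by (simp add: ee W_def)
qed

lemma adj_eq_cell_edges: "{(p, q). adj n p q} = cell_edge ` (W n \<times> edge_labels)"
proof (intro equalityI subsetI)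
  fix e assume "e \<in> {(p, q). adj n p q}"
  then obtain p q \<omega> v w where e: "e = (p, q)" "p \<noteq> q" "\<omega> \<in> W n" "v \<in> V0" "w \<in> V0"
    "p = Fw \<omega> v" "q = Fw \<omega> w"
    unfolding adj_def by blast
  obtain i j where ij: "v = vtx i" "w = vtx j" "i \<in> {1, 2, 3}" "j \<in> {1, 2, 3}"
    using e(4,5) by (auto simp: V0_def)
  have "i \<noteq> j" using e ij by auto
  then have "(i, j) \<in> edge_labels" using ij(3,4) by (auto simp: edge_labels_def)
  then have "(\<omega>, i, j) \<in> W n \<times> edge_labels" "e = cell_edge (\<omega>, i, j)"
    using e ij by (simp_all add: cell_edge_def)
  then show "e \<in> cell_edge ` (W n \<times> edge_labels)" by blast
next
  fix e assume "e \<in> cell_edge ` (W n \<times> edge_labels)"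
  then obtain \<omega> i j where e: "\<omega> \<in> W n" "(i, j) \<in> edge_labels" "e = (Fw \<omega> (vtx i), Fw \<omega> (vtx j))"
    by (auto simp: cell_edge_def)
  have "vtx i \<noteq> vtx j"
    using vtx_diff_inj[of i j j i] e(2) by (auto simp: edge_labels_def)
  then have "Fw \<omega> (vtx i) \<noteq> Fw \<omega> (vtx j)"
    using Fw_diff[of \<omega> "vtx i" "vtx j"] by auto
  moreover have "vtx i \<in> V0" "vtx j \<in> V0" using e(2) by (auto simp: edge_labels_def V0_def)
  ultimately show "e \<in> {(p, q). adj n p q}"
    using e unfolding adj_def by blast
qed

lemma sum_adj_eq_cell_form:
  "(\<Sum>(p, q)\<in>{(p, q). adj n p q}. (u p - u q)\<^sup>2) / 2 = cell_form 1 1 1 n u"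
proof -
  have "(\<Sum>(p, q)\<in>{(p, q). adj n p q}. (u p - u q)\<^sup>2) =
      (\<Sum>(\<omega>, e)\<in>W n \<times> edge_labels. (u (Fw \<omega> (vtx (fst e))) - u (Fw \<omega> (vtx (snd e))))\<^sup>2)"
    unfolding adj_eq_cell_edges sum.reindex[OF inj_on_cell_edge]
    by (rule sum.cong) (auto simp: cell_edge_def)
  also have "\<dots> = (\<Sum>\<omega>\<in>W n. \<Sum>e\<in>edge_labels. (u (Fw \<omega> (vtx (fst e))) - u (Fw \<omega> (vtx (snd e))))\<^sup>2)"
    by (rule sum.cartesian_product[symmetric])
  also have "\<dots> = 2 * cell_form 1 1 1 n u"
    unfolding cell_form_def sum_distrib_left
    by (rule sum.cong) (auto simp: edge_labels_def power2_commute)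
  finally show ?thesis by simp
qed

lemma std_form_cell_form: "std_form u = lim (\<lambda>n. ennreal ((5/3) ^ n * cell_form 1 1 1 n u))"
  unfolding std_form_def sum_adj_eq_cell_form ..

section \<open>Identification of the limit form\<close>

lemma cell_form_scale: "cell_form (k * a) (k * b) (k * c) n u = k * cell_form a b c n u"
  unfolding cell_form_def sum_distrib_left by (simp add: algebra_simps)

lemma cell_form_mono:
  assumes "a \<le> a'" "b \<le> b'" "c \<le> c'"
  shows "cell_form a b c n u \<le> cell_form a' b' c' n u"
  unfolding cell_form_def
  using assms by (intro sum_mono add_mono mult_right_mono) auto

lemma orbit_isotropic:
  assumes "orbit x y z" "x 0 = y 0" "y 0 = z 0"
  shows "x n = (3/5) ^ n * x 0 \<and> y n = x n \<and> z n = x n"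
proof -
  have eq: "y m = x m" "z m = x m" for m
    using orbit_eq[OF assms(1)] orbit_eq[OF orbit_rotate[OF assms(1)]] assms by simp_all
  have "x n = (3/5) ^ n * x 0"
  proof (induction n)
    case (Suc n)
    have "x n = x (Suc n) + phi (x (Suc n)) (x (Suc n)) (x (Suc n))"
      using orbit_step(1)[OF assms(1), of n] unfolding eq .
    also have "phi (x (Suc n)) (x (Suc n)) (x (Suc n)) = (2/3) * x (Suc n)"
      by (simp add: phi_def)
    finally show ?case using Suc by simp
  qed simp
  then show ?thesis using eq by simp
qed

text \<open>All conductances at level \<open>n\<close> equal \<open>(5/3)\<^sup>n / (3 x 0)\<close>, so each discrete energy is a
  fixed multiple of the term in the standard form. The monotonicity of the energies carries over
  to these terms and guarantees that their limit exists.\<close>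

lemma energy_isotropic:
  assumes o: "orbit x y z" and eq: "x 0 = y 0" "y 0 = z 0"
  shows "energy x y z u = ennreal (1 / (3 * x 0)) * std_form u"
proof -
  define k where "k = 1 / (3 * x 0)"
  have k: "k > 0" using orbit_pos[OF o, of 0] by (simp add: k_def)
  have E: "energy_n x y z n u = k * ((5/3) ^ n * cell_form 1 1 1 n u)" for n
  proof -
    have xn: "x n = (3/5) ^ n * x 0" "y n = x n" "z n = x n"
      using orbit_isotropic[OF assms, of n] by auto
    have "x n / (x n * x n + x n * x n + x n * x n) = k * (5/3) ^ n"
      using orbit_pos[OF o, of 0] unfolding xn k_def by (simp add: power_divide field_simps)
    then show ?thesis
      unfolding energy_n_cell_form Let_def xn(2,3)
      using cell_form_scale[of "k * (5/3) ^ n" 1 1 1 n u] by simp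
  qed
  have inc: "incseq (\<lambda>n. (5/3) ^ n * cell_form 1 1 1 n u)"
    using energy_n_mono[OF o, of u] k unfolding E incseq_def by simp
  have "energy x y z u = (SUP n. ennreal k * ennreal ((5/3) ^ n * cell_form 1 1 1 n u))"
    unfolding energy_SUP[OF o] E using k by (simp add: ennreal_mult')
  also have "\<dots> = ennreal k * (SUP n. ennreal ((5/3) ^ n * cell_form 1 1 1 n u))"
    by (rule SUP_mult_left_ennreal[symmetric])
  also have "\<dots> = ennreal k * std_form u"
    unfolding std_form_cell_form lim_ennreal_incseq[OF inc] ..
  finally show ?thesis unfolding k_def .
qed

text \<open>A discrete form depends monotonically on its conductances, so bounds on the conductances
  that are uniform in the level pass to the suprema.\<close>

lemma comparable_energy_SUP:
  assumes o: "orbit x y z" and cC: "c > 0" "C > 0"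
    and B: "\<And>n. let r = x n * y n + y n * z n + z n * x n in
      c * \<alpha> n \<le> x n / r \<and> x n / r \<le> C * \<alpha> n \<and>
      c * \<beta> n \<le> y n / r \<and> y n / r \<le> C * \<beta> n \<and>
      c * \<gamma> n \<le> z n / r \<and> z n / r \<le> C * \<gamma> n"
    and g: "\<And>u. g u = (SUP n. ennreal (cell_form (\<alpha> n) (\<beta> n) (\<gamma> n) n u))"
  shows "comparable (energy x y z) g"
proof -
  have L: "c * cell_form (\<alpha> n) (\<beta> n) (\<gamma> n) n u \<le> energy_n x y z n u"
    and U: "energy_n x y z n u \<le> C * cell_form (\<alpha> n) (\<beta> n) (\<gamma> n) n u" for n u
    unfolding energy_n_cell_form cell_form_scale[symmetric] Let_def
    using B[of n] by (auto simp: Let_def intro!: cell_form_mono)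
  have lower: "ennreal c * g u \<le> energy x y z u" for u
  proof -
    have "ennreal c * g u = (SUP n. ennreal (c * cell_form (\<alpha> n) (\<beta> n) (\<gamma> n) n u))"
      unfolding g SUP_mult_left_ennreal using cC by (simp add: ennreal_mult')
    also have "\<dots> \<le> energy x y z u"
      unfolding energy_SUP[OF o] by (intro SUP_mono') (rule ennreal_leI[OF L])
    finally show ?thesis .
  qed
  have upper: "energy x y z u \<le> ennreal C * g u" for u
  proof -
    have "energy x y z u \<le> (SUP n. ennreal (C * cell_form (\<alpha> n) (\<beta> n) (\<gamma> n) n u))"
      unfolding energy_SUP[OF o] by (intro SUP_mono') (rule ennreal_leI[OF U])
    also have "\<dots> = ennreal C * g u"
      unfolding g SUP_mult_left_ennreal using cC by (simp add: ennreal_mult')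
    finally show ?thesis .
  qed
  define M where "M = max C (1 / c)"
  have M: "M > 0" "1 / M \<le> c" "C \<le> M"
    using cC by (auto simp: M_def less_max_iff_disj field_simps max_def)
  have "ennreal (1 / M) * g u \<le> energy x y z u \<and> energy x y z u \<le> ennreal M * g u" for u
    using order_trans[OF mult_right_mono[OF ennreal_leI[OF M(2)]] lower]
      order_trans[OF upper mult_right_mono[OF ennreal_leI[OF M(3)]]] by simp
  then show ?thesis unfolding comparable_def using M(1) by blast
qed

lemma three_halves_power: "(3/2 :: real) ^ n = 2 ^ n * (3/4) ^ n"
  by (simp add: power_mult_distrib[symmetric])

lemma aniso_cell_form:
  "aniso 1 2 3 u = (SUP n. ennreal (cell_form (2 ^ n) ((3/2) ^ n) ((3/2) ^ n) n u))"
  "aniso 2 3 1 u = (SUP n. ennreal (cell_form ((3/2) ^ n) (2 ^ n) ((3/2) ^ n) n u))"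
  "aniso 3 1 2 u = (SUP n. ennreal (cell_form ((3/2) ^ n) ((3/2) ^ n) (2 ^ n) n u))"
  unfolding aniso_def cell_form_def Let_def sum_distrib_left three_halves_power
  by (simp_all add: algebra_simps power2_commute)

theorem corollary2p4:
  fixes a0 b0 c0 :: real and x y z :: "nat \<Rightarrow> real"
  assumes "a0 > 0" and "b0 > 0" and "c0 > 0"
    and "rec_construction a0 b0 c0 x y z"
  shows "(a0 = b0 \<and> b0 = c0 \<and>
            (\<exists>C::real. C > 0 \<and> (\<forall>u. continuous_on gasket u \<longrightarrow>
               energy x y z u = ennreal C * std_form u))) \<or>
         (a0 > b0 \<and> b0 = c0 \<and> comparable (energy x y z) (aniso 1 2 3)) \<or>
         (b0 > c0 \<and> c0 = a0 \<and> comparable (energy x y z) (aniso 2 3 1)) \<or>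
         (c0 > a0 \<and> a0 = b0 \<and> comparable (energy x y z) (aniso 3 1 2))"
proof -
  have o: "orbit x y z" by (rule orbit_rec_construction[OF assms])
  note o' = orbit_rotate[OF o]
  note o'' = orbit_rotate[OF o']
  define \<eta> where "\<eta> = a0 * b0 + b0 * c0 + c0 * a0"
  have \<eta>: "\<eta> > 0" using assms by (simp add: \<eta>_def add_pos_pos)
  have init: "x 0 = a0 / \<eta>" "y 0 = b0 / \<eta>" "z 0 = c0 / \<eta>"
    using assms(4) unfolding rec_construction_def \<eta>_def Let_def by blast+
  have conv: "a / \<eta> > b / \<eta> \<longleftrightarrow> a > b" "a / \<eta> = b / \<eta> \<longleftrightarrow> a = b" for a b
    using \<eta> by (auto simp: divide_less_cancel)
  consider (iso) "x 0 = y 0" "y 0 = z 0" | (a) "x 0 > y 0" "y 0 = z 0"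
    | (b) "y 0 > z 0" "z 0 = x 0" | (c) "z 0 > x 0" "x 0 = y 0"
    using orbit_cases[OF o] by blast
  then show ?thesis
  proof cases
    case iso
    have "1 / (3 * x 0) > 0" using orbit_pos[OF o, of 0] by simp
    then show ?thesis
      using iso[unfolded init conv] energy_isotropic[OF o iso] by blast
  next
    case a
    obtain c C where "c > 0" "C > 0" and B: "\<And>n. let r = x n * y n + y n * z n + z n * x n in
      c * 2 ^ n \<le> x n / r \<and> x n / r \<le> C * 2 ^ n \<and>
      c * (3/2) ^ n \<le> y n / r \<and> y n / r \<le> C * (3/2) ^ n \<and>
      c * (3/2) ^ n \<le> z n / r \<and> z n / r \<le> C * (3/2) ^ n"
      using orbit_anisotropic_conductances[OF o a] by blast
    then have "comparable (energy x y z) (aniso 1 2 3)"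
      by (intro comparable_energy_SUP[OF o _ _ _ aniso_cell_form(1)])
    then show ?thesis using a[unfolded init conv] by blast
  next
    case b
    obtain c C where "c > 0" "C > 0" and "\<And>n. let r = y n * z n + z n * x n + x n * y n in
      c * 2 ^ n \<le> y n / r \<and> y n / r \<le> C * 2 ^ n \<and>
      c * (3/2) ^ n \<le> z n / r \<and> z n / r \<le> C * (3/2) ^ n \<and>
      c * (3/2) ^ n \<le> x n / r \<and> x n / r \<le> C * (3/2) ^ n"
      using orbit_anisotropic_conductances[OF o' b] by blast
    then have "comparable (energy x y z) (aniso 2 3 1)"
      by (intro comparable_energy_SUP[where c = c and C = C, OF o _ _ _ aniso_cell_form(2)])
        (auto simp: Let_def ac_simps)
    then show ?thesis using b[unfolded init conv] by blast
  next
    case c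
    obtain c C where "c > 0" "C > 0" and "\<And>n. let r = z n * x n + x n * y n + y n * z n in
      c * 2 ^ n \<le> z n / r \<and> z n / r \<le> C * 2 ^ n \<and>
      c * (3/2) ^ n \<le> x n / r \<and> x n / r \<le> C * (3/2) ^ n \<and>
      c * (3/2) ^ n \<le> y n / r \<and> y n / r \<le> C * (3/2) ^ n"
      using orbit_anisotropic_conductances[OF o'' c] by blast
    then have "comparable (energy x y z) (aniso 3 1 2)"
      by (intro comparable_energy_SUP[where c = c and C = C, OF o _ _ _ aniso_cell_form(3)])
        (auto simp: Let_def ac_simps)
    then show ?thesis using c[unfolded init conv] by blast
  qed
qed

end
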